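(* Every locally compact $T_0$ space is a Rudin space.
   Context: For a $T_0$ space $X$, the specialization order is $x\le y$ iff $x\in\overline{\{y\}}$. $\mathsf{K}(X)$ is the set of nonempty compact saturated subsets (saturated = upper set in the specialization order). $X$ is locally compact if for each $x\in X$ and open $U\ni x$ there is $K\in\mathsf K(X)$ with $x\in\mathrm{int}\,K\subseteq K\subseteq U$. A family $\mathcal K\subseteq \mathsf K(X)$ is filtered if it is nonempty and for all $K_1,K_2\in\mathcal K$ there is $K_3\in\mathcal K$ with $K_3\subseteq K_1\cap K_2$. A nonempty subset $A$ is irreducible if whenever $A\subseteq F_1\cup F_2$ with $F_1,F_2$ closed, then $A\subseteq F_1$ or $A\subseteq F_2$. A Rudin set is a nonempty closed subset $A$ of $X$ for which there is a filtered family $\mathcal K\subseteq\mathsf K(X)$ such that $A$ is minimal (under inclusion) among the closed subsets of $X$ that meet every member of $\mathcal K$. A $T_0$ space $X$ is a Rudin space if every irreducible closed subset of $X$ is a Rudin set. *)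

theory Defs
  imports "HOL-Analysis.Analysis"
begin

(* No carrier conditions are needed here: x \<in> X closure_of {y} already forces both
   x and y to lie in topspace X. *)
definition specialization_le :: "'a topology \<Rightarrow> 'a \<Rightarrow> 'a \<Rightarrow> bool" where
  "specialization_le X x y \<longleftrightarrow> x \<in> X closure_of {y}"

definition saturated_in :: "'a topology \<Rightarrow> 'a set \<Rightarrow> bool" where
  "saturated_in X S \<longleftrightarrow>
     S \<subseteq> topspace X \<and> (\<forall>x y. x \<in> S \<and> specialization_le X x y \<longrightarrow> y \<in> S)"

definition compact_saturated_sets :: "'a topology \<Rightarrow> 'a set set" where
  "compact_saturated_sets X = {K. K \<noteq> {} \<and> compactin X K \<and> saturated_in X K}"

(* The library's locally_compact_space only asks each point to have some compact neighbourhood,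
   which is weaker than the notion below for spaces that are not Hausdorff. *)
definition locally_compact_saturated :: "'a topology \<Rightarrow> bool" where
  "locally_compact_saturated X \<longleftrightarrow>
     (\<forall>x \<in> topspace X. \<forall>U. openin X U \<and> x \<in> U \<longrightarrow>
        (\<exists>K \<in> compact_saturated_sets X. x \<in> X interior_of K \<and> K \<subseteq> U))"

definition filtered_family :: "'a set set \<Rightarrow> bool" where
  "filtered_family \<K> \<longleftrightarrow>
     \<K> \<noteq> {} \<and> (\<forall>K1 \<in> \<K>. \<forall>K2 \<in> \<K>. \<exists>K3 \<in> \<K>. K3 \<subseteq> K1 \<inter> K2)"

definition irreducible_in :: "'a topology \<Rightarrow> 'a set \<Rightarrow> bool" where
  "irreducible_in X A \<longleftrightarrow>
     A \<noteq> {} \<and> A \<subseteq> topspace X \<and>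
     (\<forall>F1 F2. closedin X F1 \<and> closedin X F2 \<and> A \<subseteq> F1 \<union> F2 \<longrightarrow> A \<subseteq> F1 \<or> A \<subseteq> F2)"

definition closed_meeting :: "'a topology \<Rightarrow> 'a set set \<Rightarrow> 'a set \<Rightarrow> bool" where
  "closed_meeting X \<K> A \<longleftrightarrow> closedin X A \<and> (\<forall>K \<in> \<K>. A \<inter> K \<noteq> {})"

definition Rudin_set :: "'a topology \<Rightarrow> 'a set \<Rightarrow> bool" where
  "Rudin_set X A \<longleftrightarrow>
     A \<noteq> {} \<and> closedin X A \<and>
     (\<exists>\<K>. \<K> \<subseteq> compact_saturated_sets X \<and> filtered_family \<K> \<and>
        closed_meeting X \<K> A \<and> (\<forall>B. closed_meeting X \<K> B \<and> B \<subseteq> A \<longrightarrow> B = A))"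

definition Rudin_space :: "'a topology \<Rightarrow> bool" where
  "Rudin_space X \<longleftrightarrow>
     t0_space X \<and> (\<forall>A. closedin X A \<and> irreducible_in X A \<longrightarrow> Rudin_set X A)"

end

theory Submission
  imports Defs
begin

text \<open>
  For an irreducible closed set \<open>A\<close>, the compact saturated sets whose interior meets \<open>A\<close> witness
  that \<open>A\<close> is a Rudin set: irreducibility makes the family filtered, and a point of
  \<open>A\<close> outside a smaller closed set \<open>B\<close> has a compact saturated neighbourhood missing \<open>B\<close>.
\<close>

text \<open>If \<open>A\<close> missed \<open>U \<inter> V\<close>, the complements of
  \<open>U\<close> and \<open>V\<close> would be two closed sets covering \<open>A\<close>; by
  irreducibility one of them would contain \<open>A\<close>, so \<open>A\<close> would miss
  \<open>U\<close> or \<open>V\<close>.\<close>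

lemma irreducible_in_meets_Int:
  assumes A: "irreducible_in X A" and U: "openin X U" "A \<inter> U \<noteq> {}"
    and V: "openin X V" "A \<inter> V \<noteq> {}"
  shows "A \<inter> (U \<inter> V) \<noteq> {}"
proof
  assume "A \<inter> (U \<inter> V) = {}"
  with A have "A \<subseteq> (topspace X - U) \<union> (topspace X - V)"
    unfolding irreducible_in_def by blast
  moreover have "closedin X (topspace X - U)" "closedin X (topspace X - V)"
    using U V by auto
  ultimately have "A \<subseteq> topspace X - U \<or> A \<subseteq> topspace X - V"
    using A unfolding irreducible_in_def by blast
  with U V show False by blast
qed

lemma locally_compact_saturatedE:
  assumes "locally_compact_saturated X" "openin X U" "x \<in> U"
  obtains K where "K \<in> compact_saturated_sets X" "x \<in> X interior_of K" "K \<subseteq> U"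
  using assms openin_subset[of X U] unfolding locally_compact_saturated_def by blast

lemma irreducible_closed_imp_Rudin_set:
  assumes lc: "locally_compact_saturated X"
    and cl: "closedin X A" and irr: "irreducible_in X A"
  shows "Rudin_set X A"
proof -
  define \<K> where "\<K> = {K \<in> compact_saturated_sets X. A \<inter> X interior_of K \<noteq> {}}"
  \<comment> \<open>Local compactness enters only here. Nonemptiness, filteredness and minimality
    all follow by choosing a suitable open \<open>U\<close> that meets \<open>A\<close>.\<close>
  have small: "\<exists>K\<in>\<K>. K \<subseteq> U" if U: "openin X U" "A \<inter> U \<noteq> {}" for U
  proof -
    from U obtain x where x: "x \<in> A" "x \<in> U" by blast
    from lc U(1) x(2) obtain K
      where "K \<in> compact_saturated_sets X" "x \<in> X interior_of K" "K \<subseteq> U"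
      by (rule locally_compact_saturatedE)
    with x show ?thesis unfolding \<K>_def by blast
  qed
  have ne: "A \<noteq> {}" "A \<subseteq> topspace X"
    using irr unfolding irreducible_in_def by auto
  have "filtered_family \<K>"
    unfolding filtered_family_def
  proof (intro conjI ballI)
    show "\<K> \<noteq> {}" using small[of "topspace X"] ne by blast
  next
    fix K1 K2 assume "K1 \<in> \<K>" "K2 \<in> \<K>"
    \<comment> \<open>Passing to interiors gives open sets, so irreducibility applies and their
      intersection can serve as \<open>U\<close> in \<open>small\<close>.\<close>
    then have "A \<inter> (X interior_of K1 \<inter> X interior_of K2) \<noteq> {}"
      using irreducible_in_meets_Int[OF irr] unfolding \<K>_def by simp
    then obtain K3 where "K3 \<in> \<K>" "K3 \<subseteq> X interior_of K1 \<inter> X interior_of K2"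
      using small[OF openin_Int[OF openin_interior_of openin_interior_of]] by blast
    then show "\<exists>K3\<in>\<K>. K3 \<subseteq> K1 \<inter> K2"
      using interior_of_subset[of X K1] interior_of_subset[of X K2] by blast
  qed
  moreover have "closed_meeting X \<K> A"
    using cl interior_of_subset[of X] unfolding closed_meeting_def \<K>_def by blast
  moreover have "B = A" if B: "closed_meeting X \<K> B" "B \<subseteq> A" for B
  proof (rule ccontr)
    assume "B \<noteq> A"
    \<comment> \<open>Here \<open>U\<close> is the complement of \<open>B\<close>: the resulting
      member of \<open>\<K>\<close> misses \<open>B\<close>, although \<open>B\<close> must meet
      every member.\<close>
    with B ne have "A \<inter> (topspace X - B) \<noteq> {}" by blast
    moreover have "openin X (topspace X - B)"
      using B(1) unfolding closed_meeting_def by blast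
    ultimately obtain K where "K \<in> \<K>" "K \<subseteq> topspace X - B"
      using small by blast
    with B(1) show False unfolding closed_meeting_def by blast
  qed
  moreover have "\<K> \<subseteq> compact_saturated_sets X" unfolding \<K>_def by blast
  ultimately show ?thesis using cl ne(1) unfolding Rudin_set_def by blast
qed

theorem theorem6p10:
  fixes X :: "'a topology"
  assumes "t0_space X" and "locally_compact_saturated X"
  shows "Rudin_space X"
  using assms irreducible_closed_imp_Rudin_set unfolding Rudin_space_def by blast

end
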